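(* Let $\eta,\varepsilon>0$, let $f,f^\ast$ be probability mass functions on the non-negative integers, let $\mathbf{D}_n\in\mathcal{D}_{\eta,\varepsilon}(f,f^\ast)$ and let $G_n=\texttt{DGA}(\mathbf{D}_n)$ be the graph produced by the Disassortative Graph Algorithm, with empirical joint degree distribution $h_n$. Let $h(k,\ell)=\psi(k,\ell)\,\mathcal{E}(k,\ell)$. For $0<\delta<\varepsilon$ and $K>0$ define the event \[ \Xi_n=\left\{\sum_{k,\ell=0}^\infty|h_n(k,\ell)-h(k,\ell)|\le Kn^{-\delta}\right\}. \] Then \[ \mathbb{P}(\Xi_n)\ \ge\ 1-O\left(n^{-\varepsilon+\delta}+\mathbb{P}(\Omega_n^c)\right)\qquad(n\to\infty). \]
   Context: A degree sequence of length $n$ is a (possibly random) vector $\mathbf{D}_n=(D_1,\dots,D_n)$ of non-negative integers with even sum $L_n=\sum_{i=1}^n D_i$. Define $f_n(k)=\frac1n\sum_{i=1}^n \mathbf{1}\{D_i=k\}$ and $f_n^\ast(k)=\frac{1}{L_n}\sum_{i=1}^n k\,\mathbf{1}\{D_i=k\}$ (with $f_n^\ast\equiv 0$ if $L_n=0$), $F_n(k)=\sum_{t\le k}f_n(t)$, $F_n^\ast(k)=\sum_{t\le k}f_n^\ast(t)$. For pmfs $f,f^\ast$ on $\{0,1,2,\dots\}$ let $F,F^\ast$ be their cdfs (all cumulative functions vanish at $-1$). $\mathbf{D}_n\in\mathcal{D}_{\eta,\varepsilon}(f,f^\ast)$ means $\sum_{k\ge0}k^{1+\eta}f(k)<\infty$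 and $\mathbb{P}(\Omega_n)\to1$, where \[ \Omega_n=\Big\{\max\Big\{\sum_{k=0}^\infty|F_n(k)-F(k)|,\ \sum_{k=0}^\infty|f_n^\ast(k)-f^\ast(k)|\Big\}\le n^{-\varepsilon}\Big\}. \] Standing assumption: $f(k)>0$ for all $k\ge0$ and $f^\ast(k)>0$ for all $k\ge1$. Functions on pairs of non-negative integers: \[ \psi(k,\ell)=\mathbf{1}\{1-F^\ast(k)<F^\ast(\ell)\}\,\mathbf{1}\{1-F^\ast(k-1)>F^\ast(\ell-1)\}, \] \[ \mathcal{E}(k,\ell)=\min(1-F^\ast(k-1),F^\ast(\ell))-\max(1-F^\ast(k),F^\ast(\ell-1)). \] Graphs are undirected multigraphs. Each undirected edge $i-j$ is replaced by two directed edges $i\to j$, $j\to i$ (so $L_n$ directed edges in total), and $h_n(k,\ell)=\frac{1}{L_n}\sum_{i\to j\in G_n}\mathbf{1}\{D_i=k\}\mathbf{1}\{D_j=\ell\}$. Disassortative Graph Algorithm (\texttt{DGA}). Input $\mathbf{D}_n$. Node $i$ has $D_i$ stubs (half-edges); $N_k$ is the number of nodes of degree $k$; $z_n$ is the unique integer with $\sum_{t=1}^{z_n}tN_t\ge L_n/2$ and $\sum_{t=1}^{z_n-1}tN_t<L_n/2$. Order the nodes $\phi(1),\dots,\phi(n)$ so that $D_{\phi(1)}\le\dots\le D_{\phi(n)}$. List $S_n$: going through $\phi(n),\phi(n-1),\dots$ as long as the degree is $\ge z_n$, append $D_{\phi(i)}$ consecutive entries $\phi(i)$. List $T_n$: for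 each degree value $k\le z_n$ in increasing order, append $k$ consecutive copies of the block listing all $N_k$ nodes of degree $k$ in the order $\phi$. For $t=1,2,\dots$ add an edge between nodes $S_n[t]$ and $T_n[t]$, stopping just before the first $t$ at which both have degree $z_n$ (or when a list is exhausted). Finally, pair the remaining unpaired stubs (all belonging to nodes of degree $z_n$) uniformly at random (configuration model). The output is the resulting multigraph, denoted $\texttt{DGA}(\mathbf{D}_n)$. Constants in $O(\cdot)$ do not depend on $n$. *)

theory Defs
  imports
    "HOL-Probability.Probability"
    "HOL-Library.Uprod"
    "HOL-Library.Multiset"
    "HOL-Library.Disjoint_Sets"
    "HOL-Library.Landau_Symbols"
begin

text \<open>
  A degree sequence of length \<open>n\<close> is a list \<open>ds\<close>; the nodes are \<open>0, \<dots>, n - 1\<close> and node \<open>i\<close> has degree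
  \<open>ds ! i\<close>. A random degree sequence is given by its law, a pmf on lists (they form a countable set,
  so nothing is lost).
\<close>

definition degree_sequence :: "nat \<Rightarrow> nat list \<Rightarrow> bool" where
  "degree_sequence n ds \<longleftrightarrow> length ds = n \<and> even (sum_list ds)"

definition emp_deg :: "nat list \<Rightarrow> nat \<Rightarrow> real" where
  "emp_deg ds k = real (count_list ds k) / real (length ds)"

text \<open>Since \<open>x / 0 = 0\<close>, the size-biased distribution is identically 0 if all degrees are 0.\<close>

definition emp_deg_sb :: "nat list \<Rightarrow> nat \<Rightarrow> real" where
  "emp_deg_sb ds k = real k * real (count_list ds k) / real (sum_list ds)"

text \<open>
  \<open>cumul g k\<close> is the cumulative function \<open>G k\<close> of \<open>g\<close>, and \<open>cumul_lt g k\<close> is \<open>G (k - 1)\<close>, with the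
  convention \<open>G (-1) = 0\<close>.
\<close>

definition cumul :: "(nat \<Rightarrow> real) \<Rightarrow> nat \<Rightarrow> real" where
  "cumul g k = (\<Sum>t\<le>k. g t)"

definition cumul_lt :: "(nat \<Rightarrow> real) \<Rightarrow> nat \<Rightarrow> real" where
  "cumul_lt g k = (\<Sum>t<k. g t)"

text \<open>
  Infinite sums of absolute values are taken in \<^typ>\<open>ennreal\<close>, so that a divergent sum is infinite
  rather than unspecified.
\<close>

definition Omega :: "real \<Rightarrow> nat pmf \<Rightarrow> nat pmf \<Rightarrow> nat \<Rightarrow> nat list set" where
  "Omega \<epsilon> f fstar n =
     {ds. max (\<Sum>k. ennreal \<bar>cumul (emp_deg ds) k - cumul (pmf f) k\<bar>)
              (\<Sum>k. ennreal \<bar>emp_deg_sb ds k - pmf fstar k\<bar>)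
          \<le> ennreal (real n powr - \<epsilon>)}"

definition degree_class ::
  "real \<Rightarrow> real \<Rightarrow> nat pmf \<Rightarrow> nat pmf \<Rightarrow> (nat \<Rightarrow> nat list pmf) \<Rightarrow> bool" where
  "degree_class \<eta> \<epsilon> f fstar D \<longleftrightarrow>
     (\<forall>n. \<forall>ds\<in>set_pmf (D n). degree_sequence n ds) \<and>
     summable (\<lambda>k. real k powr (1 + \<eta>) * pmf f k) \<and>
     (\<lambda>n. measure_pmf.prob (D n) (Omega \<epsilon> f fstar n)) \<longlonglongrightarrow> 1"

definition psi :: "nat pmf \<Rightarrow> nat \<Rightarrow> nat \<Rightarrow> real" where
  "psi fstar k l =
     of_bool (1 - cumul (pmf fstar) k < cumul (pmf fstar) l) *
     of_bool (1 - cumul_lt (pmf fstar) k > cumul_lt (pmf fstar) l)"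

definition calE :: "nat pmf \<Rightarrow> nat \<Rightarrow> nat \<Rightarrow> real" where
  "calE fstar k l =
     min (1 - cumul_lt (pmf fstar) k) (cumul (pmf fstar) l) -
     max (1 - cumul (pmf fstar) k) (cumul_lt (pmf fstar) l)"

definition limit_joint :: "nat pmf \<Rightarrow> nat \<Rightarrow> nat \<Rightarrow> real" where
  "limit_joint fstar k l = psi fstar k l * calE fstar k l"

text \<open>
  An undirected multigraph is the multiset of its edges; a self-loop at \<open>i\<close> is the edge \<open>Upair i i\<close>,
  and it yields two directed edges from \<open>i\<close> to \<open>i\<close>. The node set is fixed by the degree sequence.
\<close>

type_synonym multigraph = "nat uprod multiset"

lift_definition arcs_of_edge :: "'a uprod \<Rightarrow> ('a \<times> 'a) multiset"
  is "\<lambda>(i, j). {#(i, j), (j, i)#}"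
  by (auto simp: add_mset_commute)

definition arcs :: "multigraph \<Rightarrow> (nat \<times> nat) multiset" where
  "arcs G = (\<Sum>e\<in>#G. arcs_of_edge e)"

definition emp_joint :: "nat list \<Rightarrow> multigraph \<Rightarrow> nat \<Rightarrow> nat \<Rightarrow> real" where
  "emp_joint ds G k l =
     real (size {# (i, j) \<in># arcs G. ds ! i = k \<and> ds ! j = l #}) / real (sum_list ds)"

definition Xi :: "real \<Rightarrow> real \<Rightarrow> nat pmf \<Rightarrow> nat \<Rightarrow> (nat list \<times> multigraph) set" where
  "Xi \<delta> K fstar n =
     {(ds, G). (\<Sum>k. \<Sum>l. ennreal \<bar>emp_joint ds G k l - limit_joint fstar k l\<bar>)
               \<le> ennreal (K * real n powr - \<delta>)}"

text \<open>
  The algorithm takes an ordering \<open>\<phi>\<close> of the nodes by degree, ties being broken arbitrarily.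
  \<open>\<phi>\<close> is the list of all nodes in this order.
\<close>

definition degree_ordering :: "nat list \<Rightarrow> nat list \<Rightarrow> bool" where
  "degree_ordering ds \<phi> \<longleftrightarrow>
     mset \<phi> = mset [0..<length ds] \<and> sorted (map (\<lambda>i. ds ! i) \<phi>)"

text \<open>
  There is no such \<open>z\<close> if all degrees are 0. Its value is then irrelevant: every list below that
  enters the graph is empty, and the algorithm returns the graph without edges.
\<close>

definition dga_z :: "nat list \<Rightarrow> nat" where
  "dga_z ds = (THE z. real (\<Sum>t=1..z. t * count_list ds t) \<ge> real (sum_list ds) / 2 \<and>
                      real (\<Sum>t=1..<z. t * count_list ds t) < real (sum_list ds) / 2)"

definition dga_S :: "nat list \<Rightarrow> nat list \<Rightarrow> nat list" where
  "dga_S ds \<phi> =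
     concat (map (\<lambda>i. replicate (ds ! i) i) (takeWhile (\<lambda>i. ds ! i \<ge> dga_z ds) (rev \<phi>)))"

definition dga_T :: "nat list \<Rightarrow> nat list \<Rightarrow> nat list" where
  "dga_T ds \<phi> =
     concat (map (\<lambda>k. concat (replicate k (filter (\<lambda>i. ds ! i = k) \<phi>))) [0..<Suc (dga_z ds)])"

definition dga_pairs :: "nat list \<Rightarrow> nat list \<Rightarrow> (nat \<times> nat) list" where
  "dga_pairs ds \<phi> =
     takeWhile (\<lambda>(i, j). \<not> (ds ! i = dga_z ds \<and> ds ! j = dga_z ds)) (zip (dga_S ds \<phi>) (dga_T ds \<phi>))"

text \<open>
  Each occurrence of node \<open>i\<close> in \<open>ps\<close> uses up one of its \<open>ds ! i\<close> stubs; the unpaired stubs of \<open>i\<close>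
  are renumbered \<open>(i, 0), (i, 1), \<dots>\<close>
\<close>

definition free_stubs :: "nat list \<Rightarrow> (nat \<times> nat) list \<Rightarrow> (nat \<times> nat) set" where
  "free_stubs ds ps =
     {(i, s). i < length ds \<and>
              s < ds ! i - (count_list (map fst ps) i + count_list (map snd ps) i)}"

definition stub_pairings :: "'a set \<Rightarrow> 'a uprod set set" where
  "stub_pairings A = {M. (\<forall>e\<in>M. proper_uprod e) \<and> partition_on A (set_uprod ` M)}"

definition dga :: "nat list \<Rightarrow> nat list \<Rightarrow> multigraph pmf" where
  "dga ds \<phi> =
     map_pmf
       (\<lambda>M. mset (map (\<lambda>(i, j). Upair i j) (dga_pairs ds \<phi>)) +
            image_mset (map_uprod fst) (mset_set M))
       (pmf_of_set (stub_pairings (free_stubs ds (dga_pairs ds \<phi>))))"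

text \<open>
  The joint law of the random degree sequence and the graph produced from it, where \<open>\<phi> ds\<close> is the
  node ordering used for the input \<open>ds\<close>.
\<close>

definition dga_law ::
  "nat list pmf \<Rightarrow> (nat list \<Rightarrow> nat list) \<Rightarrow> (nat list \<times> multigraph) pmf" where
  "dga_law p \<phi> = bind_pmf p (\<lambda>ds. map_pmf (\<lambda>G. (ds, G)) (dga ds (\<phi> ds)))"

end

theory Submission
  imports Defs
begin

text \<open>
  Let \<open>Y\<close> list the degrees of all \<open>L\<close> stubs in increasing order. The algorithm pairs the reversal of
  \<open>Y\<close> with \<open>Y\<close> position by position until both degrees equal \<open>z\<close>. The arcs in the opposite direction
  account for the positions counted from the end of \<open>Y\<close>, and in the middle block both lists are
  constantly \<open>z\<close>, as are the degrees of all remaining stubs. So, whatever the random pairing does, the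
  joint degree distribution is exactly the anti-monotone coupling of the size-biased empirical
  distribution with itself. The limit \<open>h\<close> is the same coupling for \<open>f\<^sup>*\<close>. The coupling is Lipschitz in
  \<open>\<ell>\<^sup>1\<close> near \<open>f\<^sup>*\<close>, so on \<open>\<Omega>\<^sub>n\<close> the error is deterministically \<open>O(n\<^sup>-\<^sup>\<epsilon>)\<close>, and \<open>r n\<close> can be taken to be
  the probability of the complement of \<open>\<Omega>\<^sub>n\<close>.
\<close>

section \<open>Anti-monotone couplings\<close>

text \<open>For a probability mass function \<open>g\<close> this is the law of the quantiles at 1 -
  U and U for a uniform U: the length of the overlap of the interval of \<open>k\<close> in the
  reversed cdf with the interval of \<open>l\<close>, or 0 if they are disjoint.\<close>

definition antimono_coupling :: "(nat \<Rightarrow> real) \<Rightarrow> nat \<Rightarrow> nat \<Rightarrow> real" where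
  "antimono_coupling g k l =
     max 0 (min (1 - cumul_lt g k) (cumul g l) - max (1 - cumul g k) (cumul_lt g l))"

lemma cumul_eq: "cumul g k = cumul_lt g k + g k"
  unfolding cumul_def cumul_lt_def by (simp add: lessThan_Suc_atMost[symmetric])

lemma cumul_mono: "(\<And>k. 0 \<le> g k) \<Longrightarrow> k \<le> l \<Longrightarrow> cumul g k \<le> cumul g l"
  unfolding cumul_def by (rule sum_mono2) auto

lemma cumul_lt_Suc: "cumul_lt g (Suc k) = cumul g k"
  unfolding cumul_def cumul_lt_def by (simp add: lessThan_Suc_atMost)

lemma cumul_lt_0: "cumul_lt g 0 = 0"
  by (simp add: cumul_lt_def)

lemma cumul_pmf_le_1: "cumul (pmf p) k \<le> 1"
  unfolding cumul_def by (simp add: measure_measure_pmf_finite[symmetric])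

text \<open>The indicators in \<open>psi\<close> detect a proper overlap of the two intervals.
  Without one, the unclamped length is at most 0, so clamping has the same effect.\<close>

lemma limit_joint_eq_antimono_coupling:
  "limit_joint p k l = antimono_coupling (pmf p) k l"
proof -
  have "of_bool (a < d) * of_bool (b > c) * (min b d - max a c) = max 0 (min b d - max a c)"
    if "a \<le> b" "c \<le> d" for a b c d :: real
    using that by (auto simp: min_def max_def)
  then show ?thesis
    unfolding limit_joint_def psi_def calE_def antimono_coupling_def by (simp add: cumul_eq)
qed

text \<open>The reflection u to 1 - u of the unit interval exchanges the roles of the two
  intervals.\<close>

lemma antimono_coupling_commute: "antimono_coupling g k l = antimono_coupling g l k"
  unfolding antimono_coupling_def by (auto simp: min_def max_def)

text \<open>As \<open>g 0 = 0\<close>, the cell of degree 1 starts at 0, and by the choice of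
  \<open>k0\<close> it has room for everything beyond \<open>k0\<close>. The reversed interval of
  each \<open>k > k0\<close> therefore lies inside that cell, and the overlap is the whole
  interval.\<close>

lemma antimono_coupling_tail:
  assumes nn: "\<And>k. 0 \<le> g k" and g0: "g 0 = 0" and le1: "\<And>k. cumul g k \<le> 1"
    and k0: "1 - cumul g k0 \<le> cumul g 1" and k: "k0 < k"
  shows "antimono_coupling g k l = (if l = 1 then g k else 0)"
proof -
  obtain k' where k': "k = Suc k'" "k0 \<le> k'" using k by (cases k) auto
  have c0: "cumul g 0 = 0" using g0 by (simp add: cumul_def)
  have lt: "cumul_lt g k = cumul g k'" by (simp add: k' cumul_lt_Suc)
  have ge: "1 - cumul g k' \<le> cumul g 1"
    using cumul_mono[of g, OF nn k'(2)] k0 by simp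
  have step: "cumul g k = cumul g k' + g k" using lt cumul_eq[of g k] by simp
  consider "l = 0" | "l = 1" | l' where "l = Suc l'" "1 \<le> l'"
    by (cases l; cases "l - 1") auto
  then show ?thesis
  proof cases
    case 1
    then show ?thesis
      using le1[of k] unfolding antimono_coupling_def
      by (simp add: c0 cumul_lt_0 min_def max_def)
  next
    case 2
    then have "cumul_lt g l = 0" by (simp add: cumul_lt_Suc c0)
    then show ?thesis
      using 2 ge le1[of k] step nn[of k] lt unfolding antimono_coupling_def
      by (simp add: min_def max_def)
  next
    case 3
    then have "cumul_lt g l \<ge> cumul g 1"
      by (simp add: cumul_lt_Suc cumul_mono nn)
    then show ?thesis
      using 3 ge lt unfolding antimono_coupling_def
      by (simp add: min_def max_def)
  qed
qed

lemma sum_abs_diff_le: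
  fixes g g' :: "nat \<Rightarrow> real"
  assumes "(\<Sum>k. ennreal \<bar>g k - g' k\<bar>) \<le> ennreal x" and "0 \<le> x" and "finite I"
  shows "\<bar>sum g I - sum g' I\<bar> \<le> x"
proof -
  have "ennreal (\<Sum>k\<in>I. \<bar>g k - g' k\<bar>) = (\<Sum>k\<in>I. ennreal \<bar>g k - g' k\<bar>)"
    by (rule sum_ennreal[symmetric]) simp
  also have "\<dots> \<le> (\<Sum>k. ennreal \<bar>g k - g' k\<bar>)"
    by (rule sum_le_suminf) (use assms(3) in auto)
  also have "\<dots> \<le> ennreal x" by fact
  finally have "(\<Sum>k\<in>I. \<bar>g k - g' k\<bar>) \<le> x"
    using assms(2) by (simp only: ennreal_le_iff)
  moreover have "\<bar>sum g I - sum g' I\<bar> \<le> (\<Sum>k\<in>I. \<bar>g k - g' k\<bar>)"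
    by (metis sum_subtractf sum_abs)
  ultimately show ?thesis by simp
qed

text \<open>Minimum, maximum and positive part are 1-Lipschitz, so each end of the overlap moves by
  at most \<open>x\<close>.\<close>

lemma antimono_coupling_diff_le:
  assumes "\<bar>cumul g k - cumul g' k\<bar> \<le> x" "\<bar>cumul g l - cumul g' l\<bar> \<le> x"
    and "\<bar>cumul_lt g k - cumul_lt g' k\<bar> \<le> x" "\<bar>cumul_lt g l - cumul_lt g' l\<bar> \<le> x"
  shows "\<bar>antimono_coupling g k l - antimono_coupling g' k l\<bar> \<le> 2 * x"
proof -
  have lip: "\<bar>max a b - max c d\<bar> \<le> x" "\<bar>min a b - min c d\<bar> \<le> x"
    if "\<bar>a - c\<bar> \<le> x" "\<bar>b - d\<bar> \<le> x" for a b c d :: real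
    using that by (auto simp: max_def min_def abs_le_iff)
  have m: "\<bar>min (1 - cumul_lt g k) (cumul g l) - min (1 - cumul_lt g' k) (cumul g' l)\<bar> \<le> x"
    by (rule lip(2)) (use assms in \<open>auto simp: abs_le_iff\<close>)
  have M: "\<bar>max (1 - cumul g k) (cumul_lt g l) - max (1 - cumul g' k) (cumul_lt g' l)\<bar> \<le> x"
    by (rule lip(1)) (use assms in \<open>auto simp: abs_le_iff\<close>)
  have diff: "\<bar>(p - q) - (p' - q')\<bar> \<le> 2 * x" if "\<bar>p - p'\<bar> \<le> x" "\<bar>q - q'\<bar> \<le> x" for p q p' q'
    using that by arith
  have pos: "\<bar>max 0 p - max 0 q\<bar> \<le> \<bar>p - q\<bar>" for p q :: real
    by (auto simp: max_def)
  show ?thesis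
    unfolding antimono_coupling_def by (rule order_trans[OF pos diff[OF m M]])
qed

text \<open>
  Total variation is in general not controlled by the marginals through such a coupling, because a
  shift of the cdf moves every cell boundary. Here all but finitely many cells lie in the row or
  the column of degree 1, where the coupling has the entries of the marginal.
\<close>

lemma antimono_coupling_l1_le:
  fixes g g' :: "nat \<Rightarrow> real"
  assumes dist: "(\<Sum>k. ennreal \<bar>g k - g' k\<bar>) \<le> ennreal x" and x: "0 \<le> x"
    and g: "\<And>k. 0 \<le> g k" "g 0 = 0" "\<And>k. cumul g k \<le> 1" "1 - cumul g k0 \<le> cumul g 1"
    and g': "\<And>k. 0 \<le> g' k" "g' 0 = 0" "\<And>k. cumul g' k \<le> 1" "1 - cumul g' k0 \<le> cumul g' 1"
  shows "(\<Sum>k. \<Sum>l. ennreal \<bar>antimono_coupling g k l - antimono_coupling g' k l\<bar>)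
         \<le> ennreal ((2 * (real k0 + 1)\<^sup>2 + 2) * x)"
proof -
  define d where "d = (\<lambda>k. ennreal \<bar>g k - g' k\<bar>)"
  define I where "I = (\<lambda>k. of_bool (k \<le> k0) :: ennreal)"
  define J where "J = (\<lambda>k. of_bool (k = (1::nat)) :: ennreal)"
  have c: "\<bar>cumul g k - cumul g' k\<bar> \<le> x" "\<bar>cumul_lt g k - cumul_lt g' k\<bar> \<le> x" for k
    unfolding cumul_def cumul_lt_def by (auto intro!: sum_abs_diff_le[OF dist x])
  have tail: "ennreal \<bar>antimono_coupling g k l - antimono_coupling g' k l\<bar> = d k * J l"
    if "k0 < k" for k l
    using antimono_coupling_tail[of g k0 k l, OF g that] antimono_coupling_tail[of g' k0 k l, OF g' that]
    by (auto simp: d_def J_def)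
  \<comment> \<open>The majorant has three parts: the square up to \<open>k0\<close> at
    \<open>2 * x\<close> per cell, the column \<open>l = 1\<close> and the row \<open>k = 1\<close>.
    The last two each sum to the distance of the marginals, hence the constant
    \<open>2 * (k0 + 1)^2 + 2\<close>.\<close>
  have bnd: "ennreal \<bar>antimono_coupling g k l - antimono_coupling g' k l\<bar>
             \<le> ennreal (2 * x) * I k * I l + d k * J l + J k * d l" for k l
  proof (cases "k0 < k \<or> k0 < l")
    case True
    then show ?thesis
    proof
      assume "k0 < k" then show ?thesis by (simp add: tail)
    next
      assume "k0 < l" then show ?thesis
        using tail[of l k] by (simp add: antimono_coupling_commute[of _ k l] mult.commute)
    qed
  next
    case False
    then have "ennreal (2 * x) * I k * I l = ennreal (2 * x)" by (simp add: I_def)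
    moreover have "ennreal \<bar>antimono_coupling g k l - antimono_coupling g' k l\<bar> \<le> ennreal (2 * x)"
      by (rule ennreal_leI) (intro antimono_coupling_diff_le c)
    ultimately show ?thesis by (simp add: add_increasing2)
  qed
  have sI: "(\<Sum>k. I k) = ennreal (real k0 + 1)"
    by (subst suminf_finite[of "{..k0}"]) (auto simp: I_def ennreal_of_nat_eq_real_of_nat)
  have sJ: "(\<Sum>k. J k) = 1"
    by (subst suminf_finite[of "{1}"]) (auto simp: J_def)
  have sd: "(\<Sum>k. d k) \<le> ennreal x" using dist by (simp add: d_def)
  have add: "(\<Sum>n. u n + v n) = suminf u + suminf v" for u v :: "nat \<Rightarrow> ennreal"
    by (rule suminf_add[symmetric]) auto
  have "(\<Sum>k. \<Sum>l. ennreal \<bar>antimono_coupling g k l - antimono_coupling g' k l\<bar>)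
        \<le> (\<Sum>k. \<Sum>l. ennreal (2 * x) * I k * I l + d k * J l + J k * d l)"
    by (intro suminf_le bnd) auto
  also have "\<dots> = (\<Sum>k. ennreal (2 * x) * I k * suminf I + d k * suminf J + J k * suminf d)"
    unfolding add ennreal_suminf_cmult ..
  also have "\<dots> = (\<Sum>k. (ennreal (2 * x) * suminf I) * I k + suminf J * d k + suminf d * J k)"
    by (simp add: ac_simps)
  also have "\<dots> = ennreal (2 * x) * suminf I * suminf I + suminf d * suminf J + suminf J * suminf d"
    unfolding add ennreal_suminf_cmult by (simp add: ac_simps)
  also have "\<dots> \<le> ennreal (2 * x) * ennreal (real k0 + 1) * ennreal (real k0 + 1)
                + ennreal x + ennreal x"
    using sd by (intro add_mono) (simp_all add: sI sJ)
  also have "\<dots> = ennreal (2 * x * (real k0 + 1) * (real k0 + 1) + x + x)"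
    using x by (simp only: ennreal_mult ennreal_plus mult_nonneg_nonneg add_nonneg_nonneg
        of_nat_0_le_iff zero_le_numeral zero_le_one)
  also have "2 * x * (real k0 + 1) * (real k0 + 1) + x + x = (2 * (real k0 + 1)\<^sup>2 + 2) * x"
    by (simp add: power2_eq_square algebra_simps)
  finally show ?thesis .
qed

section \<open>Perfect matchings of stubs\<close>

lemma inj_set_uprod: "inj set_uprod"
proof (rule injI)
  fix e e' :: "'a uprod"
  assume "set_uprod e = set_uprod e'"
  then show "e = e'"
    by (cases e; cases e') (auto simp: doubleton_eq_iff)
qed

text \<open>Even size allows matching two points and recursing. Nonemptiness and finiteness give the
  uniform choice in \<open>dga\<close> its intended support.\<close>

lemma stub_pairings_nonempty:
  assumes "finite A" and "even (card A)"
  shows "stub_pairings A \<noteq> {}"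
  using assms
proof (induction "card A" arbitrary: A rule: less_induct)
  case less
  show ?case
  proof (cases "A = {}")
    case True
    then have "{} \<in> stub_pairings A" by (simp add: stub_pairings_def partition_on_def)
    then show ?thesis by blast
  next
    case False
    then obtain a where a: "a \<in> A" by blast
    have "A \<noteq> {a}" using less.prems by auto
    then obtain b where b: "b \<in> A" "b \<noteq> a" using a by blast
    let ?A = "A - {a, b}"
    have card: "card ?A = card A - 2"
      using a b less.prems by (subst card_Diff_subset) auto
    have "0 < card A" using a less.prems by (auto simp: card_gt_0_iff)
    then have "card ?A < card A" and "even (card ?A)"
      using card less.prems by auto
    then obtain M where M: "M \<in> stub_pairings ?A"
      using less.hyps[of ?A] less.prems by blast
    have "insert (Upair a b) M \<in> stub_pairings A"
      unfolding stub_pairings_def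
    proof (intro CollectI conjI ballI)
      fix e assume "e \<in> insert (Upair a b) M"
      then show "proper_uprod e" using M b by (auto simp: stub_pairings_def)
    next
      have "partition_on (insert a (insert b ?A)) (insert {a, b} (set_uprod ` M))"
        using M unfolding stub_pairings_def partition_on_def disjoint_def by auto
      moreover have "insert a (insert b ?A) = A" using a b by blast
      ultimately show "partition_on A (set_uprod ` insert (Upair a b) M)" by simp
    qed
    then show ?thesis by blast
  qed
qed

lemma finite_stub_pairings:
  assumes "finite A"
  shows "finite (stub_pairings A)"
proof (rule finite_subset)
  show "stub_pairings A \<subseteq> Pow ((\<lambda>(a, b). Upair a b) ` (A \<times> A))"
  proof (intro subsetI PowI)
    fix M e assume M: "M \<in> stub_pairings A" and e: "e \<in> M"
    obtain a b where ab: "e = Upair a b" by (cases e)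
    have "set_uprod e \<subseteq> A"
      using M e by (auto simp: stub_pairings_def partition_on_def)
    then show "e \<in> (\<lambda>(a, b). Upair a b) ` (A \<times> A)" using ab by force
  qed
qed (use assms in auto)

text \<open>Proper edges join two distinct stubs, so every block has size 2; a loop of the graph
  comes from two stubs of one node. Injectivity of \<open>set_uprod\<close> identifies edges with
  blocks.\<close>

lemma stub_pairingsD:
  assumes M: "M \<in> stub_pairings A" and A: "finite A"
  shows "finite M" and "2 * card M = card A" and "\<And>e. e \<in> M \<Longrightarrow> set_uprod e \<subseteq> A"
proof -
  have part: "partition_on A (set_uprod ` M)" and proper: "\<And>e. e \<in> M \<Longrightarrow> proper_uprod e"
    using M by (auto simp: stub_pairings_def)
  have inj: "inj_on set_uprod M" using inj_set_uprod by (rule inj_on_subset) simp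
  have "finite (set_uprod ` M)" using finite_elements[OF A part] .
  then show "finite M" using inj by (rule finite_imageD)
  show "set_uprod e \<subseteq> A" if "e \<in> M" for e
    using part that by (auto simp: partition_on_def)
  have "card (set_uprod e) = 2" if "e \<in> M" for e
    using proper[OF that] by (cases e) auto
  moreover have "card A = (\<Sum>S\<in>set_uprod ` M. card S)"
    unfolding partition_onD1[OF part]
    by (rule card_Union_disjoint) (use part in \<open>auto simp: partition_on_def pairwise_def disjoint_def disjnt_def\<close>)
  ultimately show "2 * card M = card A"
    by (simp add: sum.reindex[OF inj])
qed

section \<open>Sorted lists of stubs\<close>

lemma count_list_concat: "count_list (concat xss) x = sum_list (map (\<lambda>xs. count_list xs x) xss)"
  by (induction xss) auto

lemma count_list_replicate: "count_list (replicate n y) x = (if x = y then n else 0)"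
  by (induction n) auto

lemma count_list_concat_replicate:
  "count_list (concat (map (\<lambda>i. replicate (c i) i) xs)) i = c i * count_list xs i"
  by (induction xs) (auto simp: count_list_replicate)

lemma count_list_filter: "count_list (filter P xs) x = (if P x then count_list xs x else 0)"
  by (induction xs) auto

lemma count_list_take_drop: "count_list xs i = count_list (take m xs) i + count_list (drop m xs) i"
  by (metis append_take_drop_id count_list_append)

lemma count_list_sort: "count_list (sort xs) x = count_list xs x"
  by (metis count_mset mset_sort)

lemma set_dropE:
  assumes "x \<in> set (drop m xs)"
  obtains t where "m \<le> t" "t < length xs" "x = xs ! t"
proof -
  obtain u where "u < length (drop m xs)" "x = drop m xs ! u"
    using assms by (metis in_set_conv_nth)
  then show thesis using that[of "m + u"] by simp
qed

lemma sum_weighted_count_list: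
  fixes ds :: "nat list"
  assumes "finite I"
  shows "(\<Sum>t\<in>I. t * count_list ds t) = sum_list (filter (\<lambda>d. d \<in> I) ds)"
proof (induction ds)
  case (Cons d ds)
  have "(\<Sum>t\<in>I. t * count_list (d # ds) t)
        = (\<Sum>t\<in>I. (if t = d then d else 0) + t * count_list ds t)"
    by (rule sum.cong) auto
  then show ?case using Cons assms by (simp add: sum.distrib)
qed simp

lemma sorted_map_filter_append:
  assumes "sorted (map f xs)"
  shows "filter (\<lambda>x. f x < l) xs @ filter (\<lambda>x. \<not> f x < l) xs = xs"
  using assms
proof (induction xs)
  case (Cons x xs)
  show ?case
  proof (cases "f x < l")
    case False
    then have "\<forall>y\<in>set (x # xs). \<not> f y < l" using Cons.prems by auto
    then have "filter (\<lambda>x. f x < l) (x # xs) = []" "filter (\<lambda>x. \<not> f x < l) (x # xs) = x # xs"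
      by (simp_all add: filter_empty_conv filter_id_conv del: filter.simps)
    then show ?thesis by (simp del: filter.simps)
  qed (use Cons in simp)
qed simp

text \<open>Read backwards, a sorted list shows all keys at least \<open>l\<close> before any
  smaller one. This turns the first list of the algorithm into a filter of the ordering.\<close>

lemma takeWhile_rev_sorted_map:
  fixes f :: "'a \<Rightarrow> 'b :: linorder"
  assumes "sorted (map f xs)"
  shows "takeWhile (\<lambda>x. l \<le> f x) (rev xs) = rev (filter (\<lambda>x. l \<le> f x) xs)"
proof -
  have "rev xs = rev (filter (\<lambda>x. l \<le> f x) xs) @ rev (filter (\<lambda>x. f x < l) xs)"
    using sorted_map_filter_append[OF assms, of l] by (metis (lifting) linorder_not_less rev_append filter_cong)
  moreover have "takeWhile (\<lambda>x. l \<le> f x) (rev (filter (\<lambda>x. f x < l) xs)) = []"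
    using hd_in_set[of "rev (filter (\<lambda>x. f x < l) xs)"] by (fastforce simp: takeWhile_eq_Nil_iff)
  moreover have "takeWhile (\<lambda>x. l \<le> f x) (rev (filter (\<lambda>x. l \<le> f x) xs) @ ys)
      = rev (filter (\<lambda>x. l \<le> f x) xs) @ takeWhile (\<lambda>x. l \<le> f x) ys" for ys
    by (rule takeWhile_append2) auto
  ultimately show ?thesis by simp
qed

lemma concat_replicate_replicate: "concat (replicate m (replicate n x)) = replicate (m * n) x"
  by (induction m) (auto simp: replicate_add)

lemma sorted_concat_replicate_upt: "sorted (concat (map (\<lambda>k. replicate (c k) k) [0..<n]))"
  by (induction n) (auto simp: sorted_append)

lemma count_list_concat_upt:
  assumes "\<And>k. x \<in> set (h k) \<Longrightarrow> k = j"
  shows "count_list (concat (map h [0..<n])) x = (if j < n then count_list (h j) x else 0)"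
proof -
  have "count_list (h k) x = (if k = j then count_list (h j) x else 0)" for k
    using assms[of k] by (auto simp: count_list_0_iff)
  then have "count_list (concat (map h [0..<n])) x = (\<Sum>k = 0..<n. if k = j then count_list (h j) x else 0)"
    by (simp add: count_list_concat comp_def interv_sum_list_conv_sum_set_nat)
  then show ?thesis by simp
qed

lemma sorted_mset_eqD:
  assumes "sorted xs" "sorted ys" "mset xs = mset ys"
  shows "xs = ys"
  using properties_for_sort[of xs ys] assms by (simp add: sorted_sort_id)

text \<open>On \<open>sort ds\<close> this is the list \<open>Y\<close>, in which a stub keeps its
  degree but not its node.\<close>

definition degree_stubs :: "nat list \<Rightarrow> nat list" where
  "degree_stubs xs = concat (map (\<lambda>d. replicate d d) xs)"

lemma length_degree_stubs: "length (degree_stubs xs) = sum_list xs"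
  by (induction xs) (auto simp: degree_stubs_def)

lemma degree_stubs_append: "degree_stubs (xs @ ys) = degree_stubs xs @ degree_stubs ys"
  by (simp add: degree_stubs_def)

lemma filter_degree_stubs: "filter P (degree_stubs xs) = degree_stubs (filter P xs)"
  by (induction xs) (auto simp: degree_stubs_def)

lemma count_list_degree_stubs: "count_list (degree_stubs xs) k = k * count_list xs k"
  using count_list_concat_replicate[of "\<lambda>d. d"] by (simp add: degree_stubs_def)

lemma sorted_degree_stubs: "sorted xs \<Longrightarrow> sorted (degree_stubs xs)"
  by (induction xs) (auto simp: degree_stubs_def sorted_append)

lemma rev_degree_stubs: "rev (degree_stubs xs) = concat (map (\<lambda>d. replicate d d) (rev xs))"
  by (induction xs) (auto simp: degree_stubs_def)

lemma sorted_nth_less_iff: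
  fixes xs :: "'a :: linorder list"
  assumes "sorted xs" and "t < length xs"
  shows "xs ! t < l \<longleftrightarrow> t < length (filter (\<lambda>x. x < l) xs)"
proof -
  let ?u = "filter (\<lambda>x. x < l) xs" and ?v = "filter (\<lambda>x. \<not> x < l) xs"
  have eq: "?u @ ?v = xs" using sorted_map_filter_append[of "\<lambda>x. x" xs l] assms(1) by simp
  have "?u ! t < l" if "t < length ?u" using nth_mem[OF that] by simp
  moreover have "\<not> ?v ! (t - length ?u) < l" if "\<not> t < length ?u"
  proof -
    have "t - length ?u < length ?v"
      using that assms(2) arg_cong[OF eq, of length] by simp
    from nth_mem[OF this] show ?thesis by simp
  qed
  moreover have "xs ! t = (if t < length ?u then ?u ! t else ?v ! (t - length ?u))"
    by (subst eq[symmetric]) (rule nth_append)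
  ultimately show ?thesis by simp
qed

lemma sum_list_filter_sort:
  fixes ds :: "nat list"
  shows "sum_list (filter P (sort ds)) = sum_list (filter P ds)"
  by (metis mset_filter mset_sort sum_mset_sum_list)

text \<open>Entries below a threshold fill an initial segment of a sorted list. Through this
  equivalence, later claims about degrees become inequalities between positions.\<close>

lemma degree_stubs_nth_less_iff:
  assumes "t < sum_list ds"
  shows "degree_stubs (sort ds) ! t < l \<longleftrightarrow> t < sum_list (filter (\<lambda>d. d < l) ds)"
  using sorted_nth_less_iff[OF sorted_degree_stubs[OF sorted_sort[of ds]], of t l] assms
    sum_list_filter_sort[of "\<lambda>_. True" ds]
  by (simp add: filter_degree_stubs length_degree_stubs sum_list_filter_sort)

lemma zip_take_take: "zip (take a xs) (take b ys) = take (min a b) (zip xs ys)"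
  by (rule nth_equalityI) auto

section \<open>Arcs and their degree pairs\<close>

lemma arcs_of_edge_Upair:
  "arcs_of_edge (Upair i j) = {#(i, j), (j, i)#}"
  by transfer simp

lemma arcs_union: "arcs (G + H) = arcs G + arcs H"
  by (simp add: arcs_def)

lemma arcs_mset_map_Upair:
  "arcs (mset (map (\<lambda>(i, j). Upair i j) ps)) = mset ps + mset (map prod.swap ps)"
  by (induction ps) (auto simp: arcs_def arcs_of_edge_Upair)

text \<open>The graph enters only through the degree pairs of its arcs, so it suffices to determine
  that multiset.\<close>

lemma emp_joint_eq_count:
  "emp_joint ds G k l
   = real (count (image_mset (map_prod ((!) ds) ((!) ds)) (arcs G)) (k, l)) / real (sum_list ds)"
proof -
  have "count (image_mset (map_prod ((!) ds) ((!) ds)) (arcs G)) (k, l)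
        = size {# (i, j) \<in># arcs G. ds ! i = k \<and> ds ! j = l #}"
    unfolding count_conv_size_mset filter_mset_image_mset size_image_mset
    by (rule arg_cong[of _ _ size], rule filter_mset_cong) auto
  then show ?thesis by (simp add: emp_joint_def)
qed

section \<open>The joint degree distribution of the output\<close>

text \<open>A positive sum makes the threshold \<open>dga_z\<close> well defined; an even sum leaves
  an even number of free stubs.\<close>

locale dga_input =
  fixes ds \<phi> :: "nat list"
  assumes ordering: "degree_ordering ds \<phi>"
    and pos: "0 < sum_list ds"
    and even_sum: "even (sum_list ds)"
begin

abbreviation "z \<equiv> dga_z ds"
abbreviation "L \<equiv> sum_list ds"
abbreviation "stubs \<equiv> degree_stubs (sort ds)"
text \<open>An unnormalised cdf of the size-biased degrees: in \<open>stubs\<close>, degree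
  \<open>l\<close> occupies the positions from \<open>below l\<close> up to, but excluding,
  \<open>below (Suc l)\<close>.\<close>

abbreviation "below l \<equiv> sum_list (filter (\<lambda>d. d < l) ds)"

text \<open>The number of edges added before the algorithm meets two nodes of degree \<open>z\<close> or exhausts a list.\<close>

definition "paired = max (below z) (L - below (Suc z))"

section \<open>Counting stubs and the threshold degree\<close>

lemma below_mono: "k \<le> l \<Longrightarrow> below k \<le> below l"
  by (induction ds) auto

lemma below_le: "below l \<le> L"
  by (induction ds) auto

lemma below_eventually: "\<exists>l. below (Suc l) = L"
proof
  have "filter (\<lambda>d. d < Suc L) ds = ds"
    using member_le_sum_list[of _ ds] by (auto simp: filter_id_conv less_Suc_eq_le)
  then show "below (Suc L) = L" by simp
qed

lemma sum_eq_below: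
  "(\<Sum>t=1..l. t * count_list ds t) = below (Suc l)"
  "(\<Sum>t=1..<l. t * count_list ds t) = below l"
proof -
  have "(\<Sum>t=1..l. t * count_list ds t) = (\<Sum>t<Suc l. t * count_list ds t)"
    by (rule sum.mono_neutral_left) (auto simp: not_le less_Suc_eq_le)
  then show "(\<Sum>t=1..l. t * count_list ds t) = below (Suc l)"
    by (simp add: sum_weighted_count_list del: sum.lessThan_Suc)
  have "(\<Sum>t=1..<l. t * count_list ds t) = (\<Sum>t<l. t * count_list ds t)"
    by (rule sum.mono_neutral_left) (auto simp: not_le less_Suc_eq_le)
  then show "(\<Sum>t=1..<l. t * count_list ds t) = below l"
    by (simp add: sum_weighted_count_list)
qed

text \<open>Discharges the definite description in \<open>dga_z\<close>, doubled so as to stay in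
  the naturals. Two solutions would contradict monotonicity of \<open>below\<close>.\<close>

lemma z_bounds: "L \<le> 2 * below (Suc z)" "2 * below z < L"
proof -
  let ?P = "\<lambda>z. L \<le> 2 * below (Suc z) \<and> 2 * below z < L"
  have "\<exists>z. L \<le> 2 * below (Suc z)"
    using below_eventually by (metis le_add1 mult_2)
  \<comment> \<open>The least index reaching half of the stubs: minimality gives the strict bound
    one index earlier, and at index 0 it holds because \<open>below 0\<close> is 0.\<close>
  then obtain y where y: "L \<le> 2 * below (Suc y)" "\<And>x. x < y \<Longrightarrow> \<not> L \<le> 2 * below (Suc x)"
    using exists_least_iff[of "\<lambda>z. L \<le> 2 * below (Suc z)"] by blast
  have "2 * below y < L"
  proof (cases y)
    case 0
    then show ?thesis using pos by simp
  next
    case (Suc x)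
    then show ?thesis using y(2)[of x] by simp
  qed
  then have ex: "?P y" using y(1) by simp
  have uniq: "x = y" if "?P x" for x
  proof (rule ccontr)
    assume "x \<noteq> y"
    then consider "Suc x \<le> y" | "Suc y \<le> x" by linarith
    then show False
      using below_mono[of "Suc x" y] below_mono[of "Suc y" x] that ex by cases auto
  qed
  have "z = (THE z. ?P z)"
    unfolding dga_z_def sum_eq_below by (rule arg_cong[of _ _ The]) (auto simp: fun_eq_iff)
  then have "?P z" using theI[of ?P, OF ex uniq] by simp
  then show "L \<le> 2 * below (Suc z)" "2 * below z < L" by auto
qed

section \<open>Degrees along the two lists of the algorithm\<close>

lemma set_ordering: "set \<phi> = {..<length ds}"
  using ordering unfolding degree_ordering_def by (metis atLeast_upt mset_eq_setD)

lemma count_list_ordering: "i < length ds \<Longrightarrow> count_list \<phi> i = 1"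
proof -
  assume "i < length ds"
  have "count_list \<phi> i = count_list [0..<length ds] i"
    using ordering unfolding degree_ordering_def by (metis count_mset)
  also have "\<dots> = 1"
    using \<open>i < length ds\<close> distinct_count_atmost_1[of "[0..<length ds]"] by (simp add: count_mset[symmetric])
  finally show ?thesis .
qed

lemma map_ordering: "map ((!) ds) \<phi> = sort ds"
proof (rule properties_for_sort[symmetric])
  show "mset (map ((!) ds) \<phi>) = mset ds"
    using ordering unfolding degree_ordering_def by (metis map_nth mset_map)
  show "sorted (map ((!) ds) \<phi>)"
    using ordering unfolding degree_ordering_def by simp
qed

lemma dga_S_eq: "dga_S ds \<phi> = concat (map (\<lambda>i. replicate (ds ! i) i) (rev (filter (\<lambda>i. z \<le> ds ! i) \<phi>)))"
  unfolding dga_S_def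
  using takeWhile_rev_sorted_map[of "\<lambda>i. ds ! i" \<phi> z] by (simp add: map_ordering)

text \<open>The nodes of degree at least \<open>z\<close> own the last \<open>L - below z\<close>
  entries of \<open>stubs\<close>, and the algorithm visits them from the largest degree
  downwards.\<close>

lemma degrees_dga_S: "map ((!) ds) (dga_S ds \<phi>) = take (L - below z) (rev stubs)"
proof -
  have "map ((!) ds) (dga_S ds \<phi>)
        = concat (map (\<lambda>d. replicate d d) (map ((!) ds) (rev (filter (\<lambda>i. z \<le> ds ! i) \<phi>))))"
    by (simp add: dga_S_eq map_concat comp_def)
  also have "map ((!) ds) (rev (filter (\<lambda>i. z \<le> ds ! i) \<phi>)) = rev (filter (\<lambda>d. z \<le> d) (sort ds))"
    unfolding map_ordering[symmetric] by (simp add: filter_map comp_def rev_map)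
  also have "concat (map (\<lambda>d. replicate d d) \<dots>) = rev (degree_stubs (filter (\<lambda>d. \<not> d < z) (sort ds)))"
    by (simp add: rev_degree_stubs not_less)
  also have "\<dots> = take (L - below z) (rev stubs)"
  proof -
    have split: "stubs = degree_stubs (filter (\<lambda>d. d < z) (sort ds))
                    @ degree_stubs (filter (\<lambda>d. \<not> d < z) (sort ds))"
      using sorted_map_filter_append[of "\<lambda>d. d" "sort ds" z]
      by (simp add: degree_stubs_append[symmetric])
    have "length stubs = L" using sum_list_filter_sort[of "\<lambda>_. True" ds] by (simp add: length_degree_stubs)
    then have "length (degree_stubs (filter (\<lambda>d. \<not> d < z) (sort ds))) = L - below z"
      using arg_cong[OF split, of length] by (simp add: length_degree_stubs sum_list_filter_sort)
    then show ?thesis by (subst split) simp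
  qed
  finally show ?thesis .
qed

text \<open>Cycling through a block of equal-degree nodes, instead of exhausting one node after the
  other, is invisible at the level of degrees. Both sides are sorted, so comparing multiplicities
  suffices.\<close>

lemma degrees_dga_T: "map ((!) ds) (dga_T ds \<phi>) = take (below (Suc z)) stubs"
proof -
  have blocks: "map ((!) ds) (concat (replicate k (filter (\<lambda>i. ds ! i = k) \<phi>)))
        = replicate (k * count_list ds k) k" for k
  proof -
    have "map ((!) ds) (filter (\<lambda>i. ds ! i = k) \<phi>) = filter ((=) k) (sort ds)"
      unfolding map_ordering[symmetric] by (auto simp: filter_map comp_def intro!: arg_cong[of _ _ "map _"] filter_cong)
    also have "\<dots> = replicate (count_list ds k) k"
      using replicate_length_filter[of k "sort ds"]
      by (simp add: count_list_eq_length_filter[symmetric] count_mset[symmetric])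
    finally have "map ((!) ds) (filter (\<lambda>i. ds ! i = k) \<phi>) = replicate (count_list ds k) k" .
    then show ?thesis by (simp add: map_concat concat_replicate_replicate)
  qed
  have "map ((!) ds) (dga_T ds \<phi>) = concat (map (\<lambda>k. replicate (k * count_list ds k) k) [0..<Suc z])"
    unfolding dga_T_def map_concat[of _ "map h xs" for h xs] map_map comp_def blocks ..
  also have "\<dots> = degree_stubs (filter (\<lambda>d. d < Suc z) (sort ds))"
  proof (rule sorted_mset_eqD)
    show "mset (concat (map (\<lambda>k. replicate (k * count_list ds k) k) [0..<Suc z]))
          = mset (degree_stubs (filter (\<lambda>d. d < Suc z) (sort ds)))"
    proof (rule multiset_eqI)
      fix j
      have "count_list (concat (map (\<lambda>k. replicate (k * count_list ds k) k) [0..<Suc z])) j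
            = (if j < Suc z then j * count_list ds j else 0)"
        by (subst count_list_concat_upt[of j _ j]) (auto simp: count_list_replicate)
      also have "\<dots> = count_list (degree_stubs (filter (\<lambda>d. d < Suc z) (sort ds))) j"
        by (simp add: count_list_degree_stubs count_list_filter count_list_sort)
      finally show "count (mset (concat (map (\<lambda>k. replicate (k * count_list ds k) k) [0..<Suc z]))) j
          = count (mset (degree_stubs (filter (\<lambda>d. d < Suc z) (sort ds)))) j"
        by (simp only: count_mset)
    qed
  qed (rule sorted_concat_replicate_upt, simp add: sorted_degree_stubs sorted_filter[of "\<lambda>d. d", simplified])
  also have "\<dots> = take (below (Suc z)) stubs"
  proof -
    have split: "stubs = degree_stubs (filter (\<lambda>d. d < Suc z) (sort ds))
                    @ degree_stubs (filter (\<lambda>d. \<not> d < Suc z) (sort ds))"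
      using sorted_map_filter_append[of "\<lambda>d. d" "sort ds" "Suc z"]
      by (simp add: degree_stubs_append[symmetric])
    show ?thesis by (subst split) (simp add: length_degree_stubs sum_list_filter_sort)
  qed
  finally show ?thesis .
qed

lemma length_stubs: "length stubs = L"
  using sum_list_filter_sort[of "\<lambda>_. True" ds] by (simp add: length_degree_stubs)

lemma stubs_nth_less_iff: "t < L \<Longrightarrow> stubs ! t < l \<longleftrightarrow> t < below l"
  by (rule degree_stubs_nth_less_iff)

lemma stubs_nth_eq_iff: "t < L \<Longrightarrow> stubs ! t = l \<longleftrightarrow> below l \<le> t \<and> t < below (Suc l)"
  using stubs_nth_less_iff[of t l] stubs_nth_less_iff[of t "Suc l"] by auto

lemma length_dga_S: "length (dga_S ds \<phi>) = L - below z"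
  using arg_cong[OF degrees_dga_S, of length] length_stubs by simp

lemma length_dga_T: "length (dga_T ds \<phi>) = below (Suc z)"
  using arg_cong[OF degrees_dga_T, of length] length_stubs below_le[of "Suc z"] by simp

lemma dga_S_nth: "t < L - below z \<Longrightarrow> ds ! (dga_S ds \<phi> ! t) = stubs ! (L - 1 - t)"
  using arg_cong[OF degrees_dga_S, of "\<lambda>xs. xs ! t"] length_stubs length_dga_S
  by (simp add: rev_nth)

lemma dga_T_nth: "t < below (Suc z) \<Longrightarrow> ds ! (dga_T ds \<phi> ! t) = stubs ! t"
  using arg_cong[OF degrees_dga_T, of "\<lambda>xs. xs ! t"] length_stubs length_dga_T
  by simp

text \<open>By the choice of \<open>z\<close>, the block of degree \<open>z\<close> in
  \<open>stubs\<close> meets its mirror image, so the deterministic pairing stops no later than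
  halfway.\<close>

lemma paired_bounds:
  "below z \<le> paired" "L - below (Suc z) \<le> paired" "paired \<le> L - below z" "paired \<le> below (Suc z)"
  "2 * paired \<le> L"
  using z_bounds below_le[of "Suc z"] below_le[of z] below_mono[of z "Suc z"]
  unfolding paired_def by auto

text \<open>The second list reaches degree \<open>z\<close> at position \<open>below z\<close>, the
  first comes down to \<open>z\<close> at \<open>L - below (Suc z)\<close>. Both have happened from
  the maximum on, unless a list ends exactly there.\<close>

lemma dga_pairs_eq: "dga_pairs ds \<phi> = take paired (zip (dga_S ds \<phi>) (dga_T ds \<phi>))"
  unfolding dga_pairs_def
proof (rule takeWhile_eq_take_P_nth)
  fix t assume t: "t < paired" "t < length (zip (dga_S ds \<phi>) (dga_T ds \<phi>))"
  then have "\<not> (ds ! (dga_S ds \<phi> ! t) = z \<and> ds ! (dga_T ds \<phi> ! t) = z)"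
    using stubs_nth_eq_iff[of t z] stubs_nth_eq_iff[of "L - 1 - t" z] paired_bounds
    by (auto simp: dga_S_nth dga_T_nth length_dga_S length_dga_T paired_def)
  then show "case zip (dga_S ds \<phi>) (dga_T ds \<phi>) ! t of (i, j) \<Rightarrow> \<not> (ds ! i = z \<and> ds ! j = z)"
    using t by simp
next
  assume t: "paired < length (zip (dga_S ds \<phi>) (dga_T ds \<phi>))"
  then have "ds ! (dga_S ds \<phi> ! paired) = z \<and> ds ! (dga_T ds \<phi> ! paired) = z"
    using stubs_nth_eq_iff[of paired z] stubs_nth_eq_iff[of "L - 1 - paired" z] paired_bounds
    by (auto simp: dga_S_nth dga_T_nth length_dga_S length_dga_T)
  then show "\<not> (case zip (dga_S ds \<phi>) (dga_T ds \<phi>) ! paired of (i, j) \<Rightarrow> \<not> (ds ! i = z \<and> ds ! j = z))"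
    using t by simp
qed

lemma map_dga_pairs:
  "map fst (dga_pairs ds \<phi>) = take paired (dga_S ds \<phi>)"
  "map snd (dga_pairs ds \<phi>) = take paired (dga_T ds \<phi>)"
  using paired_bounds
  by (auto simp: dga_pairs_eq take_map[symmetric] take_zip length_dga_S length_dga_T)

lemma degrees_dga_pairs:
  "map (map_prod ((!) ds) ((!) ds)) (dga_pairs ds \<phi>) = take paired (zip (rev stubs) stubs)"
proof -
  have "map (map_prod ((!) ds) ((!) ds)) (dga_pairs ds \<phi>)
        = take paired (zip (map ((!) ds) (dga_S ds \<phi>)) (map ((!) ds) (dga_T ds \<phi>)))"
    by (simp add: dga_pairs_eq take_map zip_map_map map_prod_def)
  then show ?thesis
    using paired_bounds by (simp add: degrees_dga_S degrees_dga_T zip_take_take min_absorb1)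
qed

section \<open>Stubs left over for the random pairing\<close>

lemma count_dga_S: "i < length ds \<Longrightarrow> count_list (dga_S ds \<phi>) i = (if z \<le> ds ! i then ds ! i else 0)"
  by (simp add: dga_S_eq count_list_concat_replicate count_list_filter count_list_ordering)

lemma count_dga_T: "i < length ds \<Longrightarrow> count_list (dga_T ds \<phi>) i = (if ds ! i \<le> z then ds ! i else 0)"
proof -
  assume i: "i < length ds"
  have block: "count_list (concat (replicate k xs)) i = k * count_list xs i" for k and xs :: "nat list"
    by (induction k) auto
  show ?thesis
    unfolding dga_T_def
    by (subst count_list_concat_upt[of i _ "ds ! i"])
       (use i in \<open>auto simp: block count_list_filter count_list_ordering split: if_splits\<close>)
qed

definition "used i = count_list (map fst (dga_pairs ds \<phi>)) i + count_list (map snd (dga_pairs ds \<phi>)) i"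

text \<open>The cut is past both terms of the maximum, so beyond it neither list is still strictly
  on its own side of \<open>z\<close>.\<close>

lemma drop_paired_degrees:
  "i \<in> set (drop paired (dga_S ds \<phi>)) \<Longrightarrow> ds ! i \<le> z"
  "i \<in> set (drop paired (dga_T ds \<phi>)) \<Longrightarrow> z \<le> ds ! i"
proof -
  assume "i \<in> set (drop paired (dga_S ds \<phi>))"
  then obtain t where t: "t < L - below z" "paired \<le> t" "i = dga_S ds \<phi> ! t"
    by (rule set_dropE) (auto simp: length_dga_S)
  then show "ds ! i \<le> z"
    using stubs_nth_less_iff[of "L - 1 - t" "Suc z"] paired_bounds by (auto simp: dga_S_nth)
next
  assume "i \<in> set (drop paired (dga_T ds \<phi>))"
  then obtain t where t: "t < below (Suc z)" "paired \<le> t" "i = dga_T ds \<phi> ! t"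
    by (rule set_dropE) (auto simp: length_dga_T)
  then show "z \<le> ds ! i"
    using stubs_nth_less_iff[of t z] paired_bounds below_le[of "Suc z"] by (auto simp: dga_T_nth)
qed

text \<open>The list whose term attains the maximum is cut before its block of degree
  \<open>z\<close> begins.\<close>

lemma take_paired_degrees:
  "i \<in> set (take paired (dga_S ds \<phi>)) \<Longrightarrow> paired = L - below (Suc z) \<Longrightarrow> z < ds ! i"
  "i \<in> set (take paired (dga_T ds \<phi>)) \<Longrightarrow> paired = below z \<Longrightarrow> ds ! i < z"
proof -
  assume i: "i \<in> set (take paired (dga_S ds \<phi>))" and p: "paired = L - below (Suc z)"
  from i obtain t where t: "t < paired" "t < L - below z" "i = dga_S ds \<phi> ! t"
    by (fastforce simp: in_set_conv_nth length_dga_S)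
  then show "z < ds ! i"
    using stubs_nth_less_iff[of "L - 1 - t" "Suc z"] p by (auto simp: dga_S_nth)
next
  assume i: "i \<in> set (take paired (dga_T ds \<phi>))" and p: "paired = below z"
  from i obtain t where t: "t < paired" "t < below (Suc z)" "i = dga_T ds \<phi> ! t"
    by (fastforce simp: in_set_conv_nth length_dga_T)
  then show "ds ! i < z"
    using stubs_nth_less_iff[of t z] p below_le[of "Suc z"] by (auto simp: dga_T_nth)
qed

text \<open>A node of degree other than \<open>z\<close> occurs in one list only, entirely before
  the cut. A node of degree \<open>z\<close> occurs fully in both lists, but at most one of them
  shows it before the cut. Hence the natural subtraction in \<open>free_stubs\<close> never
  truncates.\<close>

lemma used_bounds:
  assumes i: "i < length ds"
  shows "used i \<le> ds ! i" and "ds ! i \<noteq> z \<Longrightarrow> used i = ds ! i"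
proof -
  let ?S = "dga_S ds \<phi>" and ?T = "dga_T ds \<phi>"
  note split = count_list_take_drop[of ?S i paired] count_list_take_drop[of ?T i paired]
    count_dga_S[OF i] count_dga_T[OF i]
  have used: "used i = count_list (take paired ?S) i + count_list (take paired ?T) i"
    by (simp add: used_def map_dga_pairs)
  show eq: "used i = ds ! i" if "ds ! i \<noteq> z"
  proof (cases "ds ! i < z")
    case True
    then have "count_list (drop paired ?T) i = 0"
      using drop_paired_degrees(2)[of i] by (auto simp: count_list_0_iff)
    then show ?thesis using split True used by simp
  next
    case False
    then have "count_list (drop paired ?S) i = 0"
      using drop_paired_degrees(1)[of i] that by (auto simp: count_list_0_iff)
    then show ?thesis using split False that used by simp
  qed
  show "used i \<le> ds ! i"
  proof (cases "ds ! i = z")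
    case True
    have "count_list (take paired ?S) i = 0 \<or> count_list (take paired ?T) i = 0"
      using take_paired_degrees[of i] True by (auto simp: count_list_0_iff paired_def max_def)
    then show ?thesis using split True used by auto
  qed (simp add: eq)
qed

lemma free_stubs_eq:
  "free_stubs ds (dga_pairs ds \<phi>) = Sigma {..<length ds} (\<lambda>i. {..<ds ! i - used i})"
  unfolding free_stubs_def used_def by auto

lemma finite_free_stubs: "finite (free_stubs ds (dga_pairs ds \<phi>))"
  by (simp add: free_stubs_eq)

lemma free_stubs_degree: "(i, s) \<in> free_stubs ds (dga_pairs ds \<phi>) \<Longrightarrow> ds ! i = z"
  using used_bounds(2)[of i] by (fastforce simp: free_stubs_eq)

text \<open>Each deterministic edge uses two stubs, so the number left has the parity of
  \<open>L\<close>.\<close>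

lemma card_free_stubs: "card (free_stubs ds (dga_pairs ds \<phi>)) = L - 2 * paired"
proof -
  let ?ps = "dga_pairs ds \<phi>"
  have len: "length ?ps = paired"
    using paired_bounds by (simp add: dga_pairs_eq length_dga_S length_dga_T)
  have "set (dga_S ds \<phi>) \<subseteq> {..<length ds}" "set (dga_T ds \<phi>) \<subseteq> {..<length ds}"
    by (auto simp: dga_S_eq dga_T_def set_ordering)
  then have sub: "set (map fst ?ps) \<subseteq> {..<length ds}" "set (map snd ?ps) \<subseteq> {..<length ds}"
    unfolding map_dga_pairs by (auto dest: in_set_takeD)
  have "(\<Sum>i<length ds. used i) = 2 * paired"
    unfolding used_def sum.distrib
    using sum_count_set[OF sub(1)] sum_count_set[OF sub(2)] len by simp
  moreover have "(\<Sum>i<length ds. ds ! i) = L"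
    by (simp add: sum_list_sum_nth atLeast0LessThan)
  moreover have "(\<Sum>i<length ds. ds ! i - used i) = (\<Sum>i<length ds. ds ! i) - (\<Sum>i<length ds. used i)"
    by (rule sum_subtractf_nat) (simp add: used_bounds)
  ultimately show ?thesis by (simp add: free_stubs_eq)
qed

text \<open>The randomness disappears here: each edge among nodes of degree \<open>z\<close>, loops
  included, gives two arcs of type \<open>(z, z)\<close>, so only the number of edges
  matters.\<close>

lemma degrees_arcs_const:
  assumes "\<And>e. e \<in># E \<Longrightarrow> set_uprod e \<subseteq> {i. ds ! i = z}"
  shows "image_mset (map_prod ((!) ds) ((!) ds)) (arcs E) = replicate_mset (2 * size E) (z, z)"
  using assms
proof (induction E)
  case empty
  then show ?case by (simp add: arcs_def)
next
  case (add e E)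
  obtain i j where e: "e = Upair i j" by (cases e)
  have "ds ! i = z" "ds ! j = z" using add.prems[of e] e by auto
  moreover have "arcs (add_mset e E) = {#(i, j), (j, i)#} + arcs E"
    by (simp add: arcs_def e arcs_of_edge_Upair)
  moreover have "image_mset (map_prod ((!) ds) ((!) ds)) (arcs E) = replicate_mset (2 * size E) (z, z)"
    by (rule add.IH) (use add.prems in auto)
  ultimately show ?case by simp
qed

section \<open>Degree pairs of all arcs\<close>

lemma zip_rev_stubs_nth: "t < L \<Longrightarrow> zip (rev stubs) stubs ! t = (stubs ! (L - 1 - t), stubs ! t)"
  by (simp add: length_stubs rev_nth)

text \<open>Reversing this list of pairs swaps their coordinates, so its last \<open>paired\<close>
  entries are the swaps of its first. A position in between and its mirror image both lie in the
  block of degree \<open>z\<close>.\<close>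

lemma mset_zip_rev_stubs:
  defines "P \<equiv> zip (rev stubs) stubs"
  shows "mset P = mset (take paired P) + mset (map prod.swap (take paired P))
                + replicate_mset (L - 2 * paired) (z, z)"
proof -
  have len: "length P = L" by (simp add: P_def length_stubs)
  have rev: "rev P = map prod.swap P"
    unfolding P_def by (subst zip_rev[symmetric]) (simp_all add: zip_commute[of stubs] prod.swap_def case_prod_beta)
  have mid: "take (L - 2 * paired) (drop paired P) = replicate (L - 2 * paired) (z, z)"
  proof (rule replicate_eqI)
    fix p assume "p \<in> set (take (L - 2 * paired) (drop paired P))"
    then obtain u where u: "u < L - 2 * paired" "p = P ! (paired + u)"
      using len by (fastforce simp: in_set_conv_nth)
    then have "stubs ! (paired + u) = z" "stubs ! (L - 1 - (paired + u)) = z"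
      using paired_bounds by (auto simp: stubs_nth_eq_iff)
    then show "p = (z, z)" using u zip_rev_stubs_nth[of "paired + u"] by (simp add: P_def)
  qed (use len in simp)
  have "drop (L - paired) P = rev (take paired (rev P))"
    using len paired_bounds by (simp add: rev_take)
  then have last: "drop (L - paired) P = rev (map prod.swap (take paired P))"
    by (simp add: rev take_map)
  have "P = take paired P @ take (L - 2 * paired) (drop paired P) @ drop (L - 2 * paired) (drop paired P)"
    by (metis append_take_drop_id)
  also have "drop (L - 2 * paired) (drop paired P) = drop (L - paired) P"
    using paired_bounds by simp
  finally have "mset P = mset (take paired P) + (mset (replicate (L - 2 * paired) (z, z))
      + mset (rev (map prod.swap (take paired P))))"
    unfolding mid last by (metis mset_append)
  then show ?thesis by (simp add: ac_simps)
qed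

text \<open>The three summands of \<open>mset_zip_rev_stubs\<close> are the arcs of the
  deterministic edges, their reversals, and the arcs of the random part.\<close>

lemma degrees_arcs_dga:
  assumes "G \<in> set_pmf (dga ds \<phi>)"
  shows "image_mset (map_prod ((!) ds) ((!) ds)) (arcs G) = mset (zip (rev stubs) stubs)"
proof -
  let ?A = "free_stubs ds (dga_pairs ds \<phi>)" and ?deg = "map_prod ((!) ds) ((!) ds)"
  have "stub_pairings ?A \<noteq> {}"
    by (rule stub_pairings_nonempty[OF finite_free_stubs]) (use even_sum in \<open>simp add: card_free_stubs\<close>)
  then obtain M where M: "M \<in> stub_pairings ?A"
    and G: "G = mset (map (\<lambda>(i, j). Upair i j) (dga_pairs ds \<phi>)) + image_mset (map_uprod fst) (mset_set M)"
    using assms unfolding dga_def by (auto simp: set_pmf_of_set finite_stub_pairings[OF finite_free_stubs])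
  note M' = stub_pairingsD[OF M finite_free_stubs]
  have "image_mset ?deg (arcs (image_mset (map_uprod fst) (mset_set M)))
        = replicate_mset (2 * size (image_mset (map_uprod fst) (mset_set M))) (z, z)"
  proof (rule degrees_arcs_const)
    fix e assume "e \<in># image_mset (map_uprod fst) (mset_set M)"
    then obtain e' where e': "e' \<in> M" "e = map_uprod fst e'" using M'(1) by auto
    obtain p q where pq: "e' = Upair p q" by (cases e')
    then have "p \<in> ?A" "q \<in> ?A" using M'(3)[OF e'(1)] by auto
    then show "set_uprod e \<subseteq> {i. ds ! i = z}"
      using e' pq free_stubs_degree[of "fst p" "snd p"] free_stubs_degree[of "fst q" "snd q"] by simp
  qed
  also have "2 * size (image_mset (map_uprod fst) (mset_set M)) = L - 2 * paired"
    using M'(2) by (simp add: card_free_stubs)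
  finally have rest: "image_mset ?deg (arcs (image_mset (map_uprod fst) (mset_set M)))
      = replicate_mset (L - 2 * paired) (z, z)" .
  have "image_mset ?deg (mset (dga_pairs ds \<phi>)) = mset (take paired (zip (rev stubs) stubs))"
    unfolding degrees_dga_pairs[symmetric] by simp
  moreover have "image_mset ?deg (mset (map prod.swap (dga_pairs ds \<phi>)))
      = mset (map prod.swap (take paired (zip (rev stubs) stubs)))"
    unfolding degrees_dga_pairs[symmetric] by (simp add: multiset.map_comp comp_def prod.swap_def)
  ultimately show ?thesis
    by (simp only: G arcs_union arcs_mset_map_Upair image_mset_union rest mset_zip_rev_stubs)
qed

text \<open>The positions of degree \<open>l\<close> form an interval, and those whose mirror image
  has degree \<open>k\<close> form another. Truncated subtraction returns 0 when they are
  disjoint.\<close>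

lemma count_zip_rev_stubs:
  "count (mset (zip (rev stubs) stubs)) (k, l)
   = min (L - below k) (below (Suc l)) - max (L - below (Suc k)) (below l)"
proof -
  have "count (mset (zip (rev stubs) stubs)) (k, l) = card {t. t < L \<and> zip (rev stubs) stubs ! t = (k, l)}"
    by (simp add: count_mset count_list_eq_length_filter length_filter_conv_card length_stubs eq_commute
        cong: conj_cong)
  also have "{t. t < L \<and> zip (rev stubs) stubs ! t = (k, l)}
      = {max (L - below (Suc k)) (below l) ..< min (L - below k) (below (Suc l))}"
    using below_le[of "Suc k"] below_le[of k] below_le[of "Suc l"]
    by (auto simp: zip_rev_stubs_nth stubs_nth_eq_iff)
  finally show ?thesis by simp
qed

lemma cumul_emp_deg_sb:
  "cumul (emp_deg_sb ds) k = real (below (Suc k)) / real L"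
  "cumul_lt (emp_deg_sb ds) k = real (below k) / real L"
proof -
  have "(\<Sum>t\<in>I. emp_deg_sb ds t) = real (sum_list (filter (\<lambda>d. d \<in> I) ds)) / real L" if "finite I" for I
    unfolding emp_deg_sb_def sum_divide_distrib[symmetric] of_nat_mult[symmetric] of_nat_sum[symmetric]
    using sum_weighted_count_list[OF that] by simp
  from this[of "{..k}"] this[of "{..<k}"] show
    "cumul (emp_deg_sb ds) k = real (below (Suc k)) / real L"
    "cumul_lt (emp_deg_sb ds) k = real (below k) / real L"
    by (simp_all add: cumul_def cumul_lt_def less_Suc_eq_le)
qed

lemma cumul_emp_deg_sb_le_1: "cumul (emp_deg_sb ds) k \<le> 1"
  using below_le[of "Suc k"] pos by (simp add: cumul_emp_deg_sb)

lemma emp_joint_dga: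
  assumes "G \<in> set_pmf (dga ds \<phi>)"
  shows "emp_joint ds G k l = antimono_coupling (emp_deg_sb ds) k l"
proof -
  have scale: "max 0 (min (a / c) (b / c) - max (a' / c) (b' / c)) = max 0 (min a b - max a' b') / c"
    if "0 < c" for a b a' b' c :: real
    using that by (auto simp: min_def max_def field_simps)
  have one: "1 - real (below i) / real L = real (L - below i) / real L" for i
  proof -
    have "1 - real a / real b = real (b - a) / real b" if "a \<le> b" "0 < b" for a b
      using that by (simp add: of_nat_diff diff_divide_distrib)
    then show ?thesis using below_le pos by blast
  qed
  \<comment> \<open>Truncated subtraction turns into the positive part in
    \<open>antimono_coupling\<close>.\<close>
  have "real (min a b - max a' b') = max 0 (min (real a) (real b) - max (real a') (real b'))" for a b a' b' :: nat
    by (auto simp: min_def max_def of_nat_diff)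
  then show ?thesis
    using pos
    by (simp add: emp_joint_eq_count degrees_arcs_dga[OF assms] count_zip_rev_stubs
        antimono_coupling_def cumul_emp_deg_sb one scale del: filter.simps)
qed

end

section \<open>Convergence\<close>

lemma cumul_pmf_tendsto: "cumul (pmf p) \<longlonglongrightarrow> 1"
proof -
  have "(\<lambda>i. measure_pmf.prob p {i}) sums measure_pmf.prob p (\<Union>i::nat. {i})"
    by (rule measure_pmf.finite_measure_UNION) (auto simp: disjoint_family_on_def)
  then have "pmf p sums 1" by (simp add: measure_pmf_single)
  then show ?thesis unfolding sums_def_le cumul_def .
qed

lemma emp_deg_sb_nonneg: "0 \<le> emp_deg_sb ds k"
  by (simp add: emp_deg_sb_def)

lemma emp_deg_sb_0: "emp_deg_sb ds 0 = 0"
  by (simp add: emp_deg_sb_def)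

text \<open>The first marginal of the joint law is \<open>p\<close>, so \<open>A\<close> keeps its
  probability there, and on the support it forces \<open>B\<close>.\<close>

lemma prob_le_bind_pair:
  assumes "\<And>x y. x \<in> set_pmf p \<Longrightarrow> x \<in> A \<Longrightarrow> y \<in> set_pmf (q x) \<Longrightarrow> (x, y) \<in> B"
  shows "measure_pmf.prob p A \<le> measure_pmf.prob (bind_pmf p (\<lambda>x. map_pmf (Pair x) (q x))) B"
proof -
  let ?r = "bind_pmf p (\<lambda>x. map_pmf (Pair x) (q x))"
  have "map_pmf fst ?r = p"
    by (simp add: map_bind_pmf pmf.map_comp comp_def map_pmf_const bind_return_pmf')
  then have "measure_pmf.prob p A = measure_pmf.prob ?r (fst -` A)"
    by (metis measure_map_pmf)
  also have "\<dots> = measure_pmf.prob ?r (fst -` A \<inter> set_pmf ?r)"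
    by (rule measure_Int_set_pmf[symmetric])
  also have "\<dots> \<le> measure_pmf.prob ?r B"
    by (rule measure_pmf.finite_measure_mono) (use assms in auto)
  finally show ?thesis .
qed

text \<open>A deterministic estimate, valid for every outcome of the pairing: the coupling bound
  applies with the same cutoff \<open>k0\<close> for both distributions.\<close>

lemma Omega_dga_l1_le:
  assumes \<Omega>: "ds \<in> Omega \<epsilon> f fstar n"
    and deg: "degree_sequence n ds" "degree_ordering ds \<phi>"
    and G: "G \<in> set_pmf (dga ds \<phi>)"
    and k0: "1 - cumul (pmf fstar) k0 \<le> pmf fstar 1 / 2"
    and small: "4 * real n powr - \<epsilon> \<le> pmf fstar 1" "pmf fstar 0 > 0 \<Longrightarrow> real n powr - \<epsilon> < pmf fstar 0"
    and f1: "0 < pmf fstar 1"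
  shows "(\<Sum>k. \<Sum>l. ennreal \<bar>emp_joint ds G k l - limit_joint fstar k l\<bar>)
         \<le> ennreal ((2 * (real k0 + 1)\<^sup>2 + 2) * real n powr - \<epsilon>)"
proof -
  define x where "x = real n powr - \<epsilon>"
  have x0: "0 \<le> x" by (simp add: x_def)
  have dist: "(\<Sum>k. ennreal \<bar>emp_deg_sb ds k - pmf fstar k\<bar>) \<le> ennreal x"
    using \<Omega> by (simp add: Omega_def x_def)
  have diff: "\<bar>cumul (emp_deg_sb ds) k - cumul (pmf fstar) k\<bar> \<le> x" for k
    unfolding cumul_def by (rule sum_abs_diff_le[OF dist x0]) simp
  \<comment> \<open>The empirical size-biased mass at 0 vanishes, so that of \<open>fstar\<close> is
    at most \<open>x\<close>; the second smallness condition then forces it to be 0.\<close>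
  have "\<bar>sum (emp_deg_sb ds) {0} - sum (pmf fstar) {0}\<bar> \<le> x"
    by (rule sum_abs_diff_le[OF dist x0]) simp
  then have "pmf fstar 0 \<le> x" by (simp add: emp_deg_sb_0)
  then have "\<not> 0 < pmf fstar 0" using small(2) by (auto simp: x_def)
  then have f0: "pmf fstar 0 = 0" using pmf_nonneg[of fstar 0] by linarith
  have f1': "pmf fstar 1 \<le> 1" by (rule pmf_le_1)
  \<comment> \<open>With all degrees 0 the empirical cdf vanishes, whereas that of
    \<open>fstar\<close> at \<open>k0\<close> is at least 1/2 and \<open>x\<close> is at most
    1/4.\<close>
  have pos: "0 < sum_list ds"
  proof (rule ccontr)
    assume "\<not> 0 < sum_list ds"
    then have "sum_list ds = 0" by simp
    then have "cumul (emp_deg_sb ds) k0 = 0"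
      by (simp only: cumul_def emp_deg_sb_def of_nat_0 div_by_0 sum.neutral_const)
    then show False using diff[of k0] k0 f1 f1' small(1) x0 by (simp add: x_def[symmetric])
  qed
  interpret dga_input ds \<phi>
    by unfold_locales (use deg pos in \<open>auto simp: degree_sequence_def\<close>)
  have c1: "cumul (pmf fstar) 1 = pmf fstar 1" using f0 by (simp add: cumul_def)
  have "(\<Sum>k. \<Sum>l. ennreal \<bar>antimono_coupling (emp_deg_sb ds) k l - antimono_coupling (pmf fstar) k l\<bar>)
        \<le> ennreal ((2 * (real k0 + 1)\<^sup>2 + 2) * x)"
  proof (rule antimono_coupling_l1_le[OF dist x0])
    \<comment> \<open>The left side is at most \<open>pmf fstar 1 / 2 + x\<close> and the right side
      at least \<open>pmf fstar 1 - x\<close>; this is where the factor 4 in the smallness condition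
      comes from.\<close>
    show "1 - cumul (emp_deg_sb ds) k0 \<le> cumul (emp_deg_sb ds) 1"
      using diff[of k0] diff[of 1] k0 c1 small(1) unfolding x_def[symmetric] abs_le_iff by linarith
    show "1 - cumul (pmf fstar) k0 \<le> cumul (pmf fstar) 1"
      using k0 c1 f1 by linarith
  qed (auto simp: emp_deg_sb_nonneg emp_deg_sb_0 cumul_emp_deg_sb_le_1 cumul_pmf_le_1 f0)
  then show ?thesis
    by (simp add: emp_joint_dga[OF G] limit_joint_eq_antimono_coupling x_def)
qed

theorem theorem3p3:
  fixes \<eta> \<epsilon> \<delta> K :: real
    and f fstar :: "nat pmf"
    and D :: "nat \<Rightarrow> nat list pmf"
    and \<phi> :: "nat list \<Rightarrow> nat list"
  assumes "\<eta> > 0" and "\<epsilon> > 0"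
    and "\<And>k. pmf f k > 0"
    and "\<And>k. k \<ge> 1 \<Longrightarrow> pmf fstar k > 0"
    and "degree_class \<eta> \<epsilon> f fstar D"
    and "\<And>n ds. ds \<in> set_pmf (D n) \<Longrightarrow> degree_ordering ds (\<phi> ds)"
    and "0 < \<delta>" and "\<delta> < \<epsilon>" and "K > 0"
  shows "\<exists>r :: nat \<Rightarrow> real.
           r \<in> O(\<lambda>n. real n powr (- \<epsilon> + \<delta>) + measure_pmf.prob (D n) (- Omega \<epsilon> f fstar n)) \<and>
           (\<forall>\<^sub>F n in sequentially.
              measure_pmf.prob (dga_law (D n) \<phi>) (Xi \<delta> K fstar n) \<ge> 1 - r n)"
proof (intro exI conjI)
  let ?r = "\<lambda>n. measure_pmf.prob (D n) (- Omega \<epsilon> f fstar n)"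
  show "?r \<in> O(\<lambda>n. real n powr (- \<epsilon> + \<delta>) + ?r n)"
    by (rule bigoI[of _ 1]) simp
  have f1: "0 < pmf fstar 1" using assms(4) by simp
  \<comment> \<open>The tail beyond \<open>k0\<close> takes at most half of the cell of degree 1;
    the other half absorbs the empirical fluctuation.\<close>
  have "\<forall>\<^sub>F k in sequentially. 1 - pmf fstar 1 / 2 < cumul (pmf fstar) k"
    using order_tendstoD(1)[OF cumul_pmf_tendsto] f1 by simp
  from eventually_happens'[OF sequentially_bot this]
  obtain k0 where "1 - pmf fstar 1 / 2 < cumul (pmf fstar) k0" by blast
  then have k0: "1 - cumul (pmf fstar) k0 \<le> pmf fstar 1 / 2" by simp
  define C where "C = 2 * (real k0 + 1)\<^sup>2 + 2"
  have null: "(\<lambda>n. real n powr - a) \<longlonglongrightarrow> 0" if "0 < a" for a :: real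
    using that by (intro tendsto_neg_powr filterlim_real_sequentially) auto
  have small1: "\<forall>\<^sub>F n in sequentially. real n powr - \<epsilon> < pmf fstar 1 / 4"
    by (rule order_tendstoD(2)[OF null[OF \<open>\<epsilon> > 0\<close>]]) (use f1 in simp)
  \<comment> \<open>If \<open>fstar\<close> has mass at 0, the event \<open>Omega\<close> is empty
    for all large \<open>n\<close>.\<close>
  have small0: "\<forall>\<^sub>F n in sequentially. pmf fstar 0 > 0 \<longrightarrow> real n powr - \<epsilon> < pmf fstar 0"
    using order_tendstoD(2)[OF null[OF \<open>\<epsilon> > 0\<close>], of "pmf fstar 0"]
    by (cases "pmf fstar 0 > 0") (auto elim: eventually_mono)
  \<comment> \<open>The gap between \<open>\<delta>\<close> and \<open>\<epsilon>\<close> absorbs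
    the constant \<open>C\<close>, so every positive \<open>K\<close> works eventually.\<close>
  have "\<forall>\<^sub>F n in sequentially. real n powr - (\<epsilon> - \<delta>) < K / C"
    by (rule order_tendstoD(2)[OF null]) (use \<open>\<delta> < \<epsilon>\<close> \<open>K > 0\<close> in \<open>auto simp: C_def intro!: divide_pos_pos add_nonneg_pos\<close>)
  then have smallC: "\<forall>\<^sub>F n in sequentially. C * real n powr - \<epsilon> \<le> K * real n powr - \<delta>"
  proof eventually_elim
    case (elim n)
    have C: "0 < C" by (simp add: C_def add_nonneg_pos)
    have "C * real n powr - \<epsilon> = (C * real n powr - (\<epsilon> - \<delta>)) * real n powr - \<delta>"
      by (simp add: powr_add[symmetric])
    also have "\<dots> \<le> K * real n powr - \<delta>"
      using elim C by (intro mult_right_mono) (auto simp: field_simps)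
    finally show ?case .
  qed
  show "\<forall>\<^sub>F n in sequentially. measure_pmf.prob (dga_law (D n) \<phi>) (Xi \<delta> K fstar n) \<ge> 1 - ?r n"
    using small1 small0 smallC
  proof eventually_elim
    case (elim n)
    have "1 - ?r n = measure_pmf.prob (D n) (Omega \<epsilon> f fstar n)"
      using measure_pmf.prob_compl[of "Omega \<epsilon> f fstar n" "D n"] by (simp add: Compl_eq_Diff_UNIV)
    also have "\<dots> \<le> measure_pmf.prob (dga_law (D n) \<phi>) (Xi \<delta> K fstar n)"
      unfolding dga_law_def
    proof (rule prob_le_bind_pair)
      fix ds G
      assume ds: "ds \<in> set_pmf (D n)" "ds \<in> Omega \<epsilon> f fstar n" and G: "G \<in> set_pmf (dga ds (\<phi> ds))"
      have "degree_sequence n ds" using assms(5) ds by (simp add: degree_class_def)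
      then have "(\<Sum>k. \<Sum>l. ennreal \<bar>emp_joint ds G k l - limit_joint fstar k l\<bar>)
          \<le> ennreal (C * real n powr - \<epsilon>)"
        unfolding C_def
        by (rule Omega_dga_l1_le[OF ds(2) _ assms(6)[OF ds(1)] G k0 _ _ f1]) (use elim(1,2) in linarith, use elim(2) in blast)
      also have "\<dots> \<le> ennreal (K * real n powr - \<delta>)"
        by (rule ennreal_leI) (rule elim(3))
      finally show "(ds, G) \<in> Xi \<delta> K fstar n" by (simp add: Xi_def)
    qed
    finally show ?case .
  qed
qed

end
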